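(* Suppose $B\in\mathbb{R}^{m\times m}$ is invertible and $B=TW$ with $T=T^T\in\mathbb{R}^{m\times m}$ and $W=W^T\in\mathbb{R}^{m\times m}$. If all $m$ eigenvalues of $B$ are non-real, then $m$ is even and $$\text{inertia of } T = \left(\tfrac{1}{2}m,\tfrac{1}{2}m,0\right) = \text{inertia of } W .$$
   Context: The inertia of a real symmetric matrix is the triple $(p,n,z)$, where $p$, $n$ and $z$ are respectively the numbers of positive, negative and zero eigenvalues, counted with multiplicity. "Non-real" refers to complex numbers with non-vanishing imaginary part. The $m$ eigenvalues of $B$ are its eigenvalues in $\mathbb{C}$ counted with algebraic multiplicity. *)

theory Defs
  imports "Jordan_Normal_Form.Char_Poly"
begin

text \<open>
  The components count the positive, negative and zero eigenvalues in that order, each eigenvalue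
  \<open>x\<close> being counted \<open>order x (char_poly A)\<close> times. Only real eigenvalues enter, which for
  symmetric \<open>A\<close> are all eigenvalues.
\<close>

definition inertia :: "real mat \<Rightarrow> nat \<times> nat \<times> nat" where
  "inertia A =
    (\<Sum>x | eigenvalue A x \<and> x > 0. order x (char_poly A),
     \<Sum>x | eigenvalue A x \<and> x < 0. order x (char_poly A),
     \<Sum>x | eigenvalue A x \<and> x = 0. order x (char_poly A))"

end

theory Submission
  imports Defs
begin

text \<open>
  Every matrix \<open>(cos t) T + (sin t) T W T = ((cos t) I + (sin t) B) T\<close> is symmetric, and it is
  invertible because \<open>B\<close> has no real eigenvalue. The number of positive eigenvalues is locally
  constant along a continuous path of invertible symmetric matrices, so its values at the ends
  \<open>T\<close> (\<open>t = 0\<close>) and \<open>-T\<close> (\<open>t = \<pi>\<close>) agree: \<open>T\<close> has as many positive as negative eigenvalues. The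
  path \<open>W ((cos t) I + (sin t) B)\<close> does the same for \<open>W\<close>.
\<close>

section \<open>Real spectra of symmetric matrices and inertia as a count of roots\<close>

text \<open>For an eigenvector \<open>v\<close>, the form \<open>q\<close> = v* A v equals
  \<open>z\<close> times the squared norm \<open>N\<close> of \<open>v\<close>. Since
  \<open>A\<close> is real and symmetric, \<open>q\<close> is its own conjugate, and
  \<open>N\<close> is nonzero.\<close>

lemma symmetric_eigenvalue_real:
  fixes A :: "real mat"
  assumes A: "A \<in> carrier_mat n n" and sym: "transpose_mat A = A"
    and ev: "eigenvalue (map_mat complex_of_real A) z"
  shows "z \<in> \<real>"
proof -
  let ?C = "map_mat complex_of_real A"
  obtain v where v: "v \<in> carrier_vec n" "v \<noteq> 0\<^sub>v n" and Cv: "?C *\<^sub>v v = z \<cdot>\<^sub>v v"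
    using ev A unfolding eigenvalue_def eigenvector_def by auto
  have row: "(\<Sum>j<n. of_real (A $$ (i,j)) * v $ j) = z * v $ i" if "i < n" for i
  proof -
    have "(?C *\<^sub>v v) $ i = (z \<cdot>\<^sub>v v) $ i" using Cv by simp
    then show ?thesis using that A v
      by (simp add: scalar_prod_def atLeast0LessThan)
  qed
  have symij: "A $$ (j,i) = A $$ (i,j)" if "i < n" "j < n" for i j
    using arg_cong[OF sym, of "\<lambda>M. M $$ (i,j)"] that A by simp
  define N where "N = (\<Sum>i<n. (cmod (v $ i))\<^sup>2)"
  define q where "q = (\<Sum>i<n. \<Sum>j<n. cnj (v $ i) * of_real (A $$ (i,j)) * v $ j)"
  have "q = (\<Sum>i<n. cnj (v $ i) * (z * v $ i))"
    unfolding q_def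
    by (intro sum.cong refl) (simp add: row[symmetric] sum_distrib_left mult.assoc)
  also have "\<dots> = z * of_real N"
    unfolding N_def of_real_sum sum_distrib_left
    by (intro sum.cong refl) (simp add: complex_norm_square mult_ac del: of_real_power)
  finally have q: "q = z * of_real N" .
  have "cnj q = (\<Sum>i<n. \<Sum>j<n. v $ i * of_real (A $$ (i,j)) * cnj (v $ j))"
    unfolding q_def by simp
  also have "\<dots> = (\<Sum>j<n. \<Sum>i<n. v $ i * of_real (A $$ (i,j)) * cnj (v $ j))"
    by (rule sum.swap)
  also have "\<dots> = q"
    unfolding q_def by (intro sum.cong refl) (simp add: symij mult_ac)
  finally have "cnj z * of_real N = z * of_real N" using q by simp
  moreover have "N \<noteq> 0"
  proof
    assume "N = 0"
    then have "\<forall>i<n. v $ i = 0"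
      unfolding N_def by (subst (asm) sum_nonneg_eq_0_iff) auto
    then have "v = 0\<^sub>v n" using v by (intro eq_vecI) auto
    with v show False by simp
  qed
  ultimately have "cnj z = z" by simp
  then show ?thesis by (simp add: Reals_cnj_iff)
qed

lemma of_real_poly_prod:
  "map_poly complex_of_real (\<Prod>i\<in>I. f i) = (\<Prod>i\<in>I. map_poly complex_of_real (f i))"
proof -
  interpret map_poly_inj_idom_hom complex_of_real ..
  show ?thesis by (rule hom_prod)
qed

lemma eigenvalue_zero_iff_det:
  fixes A :: "'a::field mat"
  assumes A: "A \<in> carrier_mat n n"
  shows "eigenvalue A 0 \<longleftrightarrow> det A = 0"
proof -
  have "char_matrix A 0 = A" using A by (intro eq_matI) (auto simp: char_matrix_def)
  then show ?thesis by (simp add: eigenvalue_det[OF A])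
qed

lemma char_poly_root_nonzero:
  fixes A :: "'a::field mat" and l :: "nat \<Rightarrow> 'a"
  assumes A: "A \<in> carrier_mat n n" and l: "char_poly A = (\<Prod>i<k. [:- l i, 1:])"
    and det: "det A \<noteq> 0" and i: "i < k"
  shows "l i \<noteq> 0"
proof
  assume "l i = 0"
  then have "poly (char_poly A) 0 = 0" using i by (auto simp: l poly_prod)
  then show False
    using det by (simp add: eigenvalue_root_char_poly[OF A, symmetric] eigenvalue_zero_iff_det[OF A])
qed

text \<open>Over the complex numbers the characteristic polynomial splits, and all its roots are
  real by the previous result. The factorization therefore descends to the reals, as the embedding
  of coefficients is injective.\<close>

lemma symmetric_char_poly_factorized:
  fixes A :: "real mat"
  assumes A: "A \<in> carrier_mat n n" and sym: "transpose_mat A = A"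
  shows "\<exists>l. char_poly A = (\<Prod>i<n. [:- l i, 1:])"
proof -
  let ?C = "map_mat complex_of_real A"
  have C: "?C \<in> carrier_mat n n" using A by simp
  obtain as where as: "char_poly ?C = (\<Prod>a\<leftarrow>as. [:- a, 1:])" and len: "length as = n"
    using char_poly_factorized[OF C] by blast
  have real: "of_real (Re a) = a" if "a \<in> set as" for a
  proof -
    have "poly (char_poly ?C) a = 0" unfolding as using that by (rule linear_poly_root)
    then have "eigenvalue ?C a" using eigenvalue_root_char_poly[OF C] by simp
    then show ?thesis using symmetric_eigenvalue_real[OF A sym] by simp
  qed
  have "map_poly complex_of_real (char_poly A) = (\<Prod>i<n. [:- (as ! i), 1:])"
    unfolding of_real_hom.char_poly_hom[OF A, symmetric] as prod.list_conv_set_nth len[symmetric]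
    by (simp add: atLeast0LessThan)
  also have "\<dots> = (\<Prod>i<n. map_poly complex_of_real [:- Re (as ! i), 1:])"
    using real len by (intro prod.cong) (auto simp: real)
  also have "\<dots> = map_poly complex_of_real (\<Prod>i<n. [:- Re (as ! i), 1:])"
    by (simp add: of_real_poly_prod)
  finally have "char_poly A = (\<Prod>i<n. [:- Re (as ! i), 1:])"
    by (simp add: poly_eq_iff coeff_map_poly)
  then show ?thesis by (intro exI[of _ "\<lambda>i. Re (as ! i)"])
qed

lemma order_prod_linear:
  fixes l :: "nat \<Rightarrow> 'a::idom"
  shows "order x (\<Prod>i<n. [:- l i, 1:]) = card {i. i < n \<and> l i = x}"
proof (induction n)
  case 0
  show ?case by (simp add: order_0I)
next
  case (Suc n)
  have lin: "order x [:- l n, 1:] = (if l n = x then 1 else 0)"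
    using order_power_n_n[of x 1] by (auto intro: order_0I)
  have split: "{i. i < Suc n \<and> l i = x} =
      (if l n = x then insert n {i. i < n \<and> l i = x} else {i. i < n \<and> l i = x})"
    by (auto simp: less_Suc_eq)
  show ?case
    by (simp del: mult_pCons_left mult_pCons_right add: order_mult Suc lin split)
qed

text \<open>The index set splits into the fibres of \<open>l\<close>, and the size of a fibre is the
  multiplicity of its root. From here on inertia is read off from the signs in a list of
  \<open>n\<close> roots, which can be followed under limits.\<close>

lemma inertia_eq_card:
  fixes A :: "real mat"
  assumes A: "A \<in> carrier_mat n n" and l: "char_poly A = (\<Prod>i<n. [:- l i, 1:])"
  shows "inertia A = (card {i. i < n \<and> l i > 0}, card {i. i < n \<and> l i < 0},
    card {i. i < n \<and> l i = 0})"
proof -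
  have ev: "eigenvalue A x \<longleftrightarrow> (\<exists>i<n. l i = x)" for x
    unfolding eigenvalue_root_char_poly[OF A] l by (auto simp: poly_prod)
  have "(\<Sum>x | eigenvalue A x \<and> P x. order x (char_poly A)) = card {i. i < n \<and> P (l i)}" for P
  proof -
    let ?E = "{x. eigenvalue A x \<and> P x}"
    have fin: "finite ?E"
      by (rule finite_subset[of _ "l ` {..<n}"]) (auto simp: ev)
    have "{i. i < n \<and> P (l i)} = (\<Union>x\<in>?E. {i. i < n \<and> l i = x})"
      by (auto simp: ev)
    also have "card \<dots> = (\<Sum>x\<in>?E. card {i. i < n \<and> l i = x})"
      by (rule card_UN_disjoint[OF fin]) auto
    finally show ?thesis by (simp add: l order_prod_linear)
  qed
  from this[of "\<lambda>x. x > 0"] this[of "\<lambda>x. x < 0"] this[of "\<lambda>x. x = 0"]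
  show ?thesis by (simp only: inertia_def)
qed

section \<open>Continuity of characteristic polynomials and of their roots\<close>

lemma tendsto_det:
  fixes X :: "'b \<Rightarrow> 'a::{real_normed_field} mat"
  assumes "\<And>k. X k \<in> carrier_mat n n" and "A \<in> carrier_mat n n"
    and "\<And>i j. i < n \<Longrightarrow> j < n \<Longrightarrow> ((\<lambda>k. X k $$ (i,j)) \<longlongrightarrow> A $$ (i,j)) F"
  shows "((\<lambda>k. det (X k)) \<longlongrightarrow> det A) F"
  unfolding det_def'[OF assms(1)] det_def'[OF assms(2)]
  by (intro tendsto_sum tendsto_mult tendsto_const tendsto_prod assms(3))
    (auto simp: permutes_in_image[of _ "{0..<n}"] dest: permutes_in_image[of _ "{0..<n}"])

text \<open>The field is left general because both cases occur below: the complex one at the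
  imaginary unit, to bound the roots, and the real one at every point, to identify their
  limits.\<close>

lemma tendsto_char_poly:
  fixes X :: "'b \<Rightarrow> 'a::{real_normed_field} mat"
  assumes X: "\<And>k. X k \<in> carrier_mat n n" and A: "A \<in> carrier_mat n n"
    and lim: "\<And>i j. i < n \<Longrightarrow> j < n \<Longrightarrow> ((\<lambda>k. X k $$ (i,j)) \<longlongrightarrow> A $$ (i,j)) F"
  shows "((\<lambda>k. poly (char_poly (X k)) x) \<longlongrightarrow> poly (char_poly A) x) F"
  unfolding char_poly_matrix[OF X] char_poly_matrix[OF A]
proof (rule tendsto_det)
  fix i j assume ij: "i < n" "j < n"
  have entry: "(- char_matrix M x) $$ (i,j) = (if i = j then x else 0) - M $$ (i,j)"
    if "M \<in> carrier_mat n n" for M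
    using that ij by (auto simp: char_matrix_def)
  show "((\<lambda>k. (- char_matrix (X k) x) $$ (i,j)) \<longlongrightarrow> (- char_matrix A x) $$ (i,j)) F"
    unfolding entry[OF X] entry[OF A] by (intro tendsto_diff tendsto_const lim ij)
qed (use X A in auto)

text \<open>Bolzano-Weierstrass one coordinate at a time: each step refines the previous subsequence
  to one that is monotone, hence convergent, in the new coordinate.\<close>

lemma common_convergent_subseq:
  fixes L :: "nat \<Rightarrow> nat \<Rightarrow> real"
  assumes "\<And>k i. i < n \<Longrightarrow> \<bar>L k i\<bar> \<le> M"
  shows "\<exists>r l. strict_mono r \<and> (\<forall>i<n. (\<lambda>k. L (r k) i) \<longlonglongrightarrow> l i)"
  using assms
proof (induction n)
  case 0
  show ?case using strict_mono_id by (auto simp: id_def)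
next
  case (Suc n)
  then obtain r l where r: "strict_mono r" and l: "\<And>i. i < n \<Longrightarrow> (\<lambda>k. L (r k) i) \<longlonglongrightarrow> l i"
    by fastforce
  obtain f :: "nat \<Rightarrow> nat" where f: "strict_mono f" "monoseq (\<lambda>k. L (r (f k)) n)"
    using seq_monosub[of "\<lambda>k. L (r k) n"] by auto
  have "Bseq (\<lambda>k. L (r (f k)) n)"
    using Suc.prems by (intro BseqI'[of _ M]) auto
  then obtain c where c: "(\<lambda>k. L (r (f k)) n) \<longlonglongrightarrow> c"
    using Bseq_monoseq_convergent f(2) unfolding convergent_def by blast
  have "(\<lambda>k. L ((r \<circ> f) k) i) \<longlonglongrightarrow> (l(n := c)) i" if "i < Suc n" for i
  proof (cases "i = n")
    case False
    then have "(\<lambda>k. L (r k) i) \<longlonglongrightarrow> l i" using that l by simp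
    from LIMSEQ_subseq_LIMSEQ[OF this f(1)] False show ?thesis by (simp add: o_def)
  qed (use c in simp)
  then show ?case using strict_mono_o[OF r f(1)] by blast
qed

text \<open>
  A bound on all eigenvalues that depends continuously on the matrix: evaluated at \<open>\<i>\<close>, the
  characteristic polynomial is a product of factors of modulus at least \<open>1\<close>.
\<close>

lemma abs_root_le_norm_char_poly_imaginary_unit:
  fixes A :: "real mat"
  assumes A: "A \<in> carrier_mat n n" and l: "char_poly A = (\<Prod>i<n. [:- l i, 1:])" and i: "i < n"
  shows "\<bar>l i\<bar> \<le> cmod (poly (char_poly (map_mat complex_of_real A)) \<i>)"
proof -
  have ge: "cmod (\<i> - of_real x) \<ge> 1" "cmod (\<i> - of_real x) \<ge> \<bar>x\<bar>" for x
    using abs_Im_le_cmod[of "\<i> - of_real x"] abs_Re_le_cmod[of "\<i> - of_real x"] by auto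
  have "char_poly (map_mat complex_of_real A) = (\<Prod>i<n. [:- of_real (l i), 1:])"
    unfolding of_real_hom.char_poly_hom[OF A] l by (simp add: of_real_poly_prod)
  then have "cmod (poly (char_poly (map_mat complex_of_real A)) \<i>) = (\<Prod>j<n. cmod (\<i> - of_real (l j)))"
    by (simp add: poly_prod prod_norm)
  also have "\<dots> = cmod (\<i> - of_real (l i)) * (\<Prod>j\<in>{..<n} - {i}. cmod (\<i> - of_real (l j)))"
    using i by (simp add: prod.remove)
  also have "\<dots> \<ge> \<bar>l i\<bar> * 1"
    using ge by (intro mult_mono prod_ge_1) auto
  finally show ?thesis by simp
qed

section \<open>Local constancy of the number of positive eigenvalues\<close>

text \<open>Along a subsequence the roots of \<open>X k\<close> converge, and the limits are the
  roots of \<open>A\<close>. These are nonzero, so the signs eventually agree. A single index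
  \<open>k\<close> suffices for the later argument by contradiction.\<close>

lemma pos_inertia_limit:
  fixes X :: "nat \<Rightarrow> real mat"
  assumes X: "\<And>k. X k \<in> carrier_mat n n" and A: "A \<in> carrier_mat n n"
    and symX: "\<And>k. transpose_mat (X k) = X k"
    and det: "det A \<noteq> 0"
    and lim: "\<And>i j. i < n \<Longrightarrow> j < n \<Longrightarrow> (\<lambda>k. X k $$ (i,j)) \<longlonglongrightarrow> A $$ (i,j)"
  shows "\<exists>k. fst (inertia (X k)) = fst (inertia A)"
proof -
  obtain L where L: "\<And>k. char_poly (X k) = (\<Prod>i<n. [:- L k i, 1:])"
    using symmetric_char_poly_factorized[OF X symX] by metis
  let ?c = "\<lambda>M. poly (char_poly (map_mat complex_of_real M)) \<i>"
  \<comment> \<open>A convergent sequence is bounded, which gives one bound \<open>M\<close> for all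
    roots of all \<open>X k\<close>.\<close>
  have "(\<lambda>k. ?c (X k)) \<longlonglongrightarrow> ?c A"
  proof (rule tendsto_char_poly)
    fix i j assume "i < n" "j < n"
    then show "(\<lambda>k. map_mat complex_of_real (X k) $$ (i,j)) \<longlonglongrightarrow> map_mat complex_of_real A $$ (i,j)"
      using X A lim tendsto_of_real by (fastforce simp: carrier_matD[OF X])
  qed (use X A in auto)
  then have "Bseq (\<lambda>k. ?c (X k))" by (blast intro: convergent_imp_Bseq convergentI)
  then obtain M where "\<And>k. cmod (?c (X k)) \<le> M" by (auto simp: Bseq_def)
  then have "\<bar>L k i\<bar> \<le> M" if "i < n" for k i
    using abs_root_le_norm_char_poly_imaginary_unit[OF X L that] order_trans by blast
  then obtain r l where r: "strict_mono r" and l: "\<And>i. i < n \<Longrightarrow> (\<lambda>k. L (r k) i) \<longlonglongrightarrow> l i"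
    using common_convergent_subseq by metis
  \<comment> \<open>Both sides are limits of the same values along the subsequence; agreement at
    every real \<open>x\<close> then makes the polynomials equal.\<close>
  have poly_eq: "poly (char_poly A) x = poly (\<Prod>i<n. [:- l i, 1:]) x" for x
  proof (rule LIMSEQ_unique)
    show "(\<lambda>k. poly (char_poly (X (r k))) x) \<longlonglongrightarrow> poly (char_poly A) x"
      using LIMSEQ_subseq_LIMSEQ[OF tendsto_char_poly[OF X A lim] r] by (simp add: o_def)
    show "(\<lambda>k. poly (char_poly (X (r k))) x) \<longlonglongrightarrow> poly (\<Prod>i<n. [:- l i, 1:]) x"
      unfolding L poly_prod by (auto intro!: tendsto_intros l)
  qed
  then have cA: "char_poly A = (\<Prod>i<n. [:- l i, 1:])"
    by (intro poly_eq_poly_eq_iff[THEN iffD1] ext)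
  have "l i \<noteq> 0" if "i < n" for i
    by (rule char_poly_root_nonzero[OF A cA det that])
  then have "eventually (\<lambda>k. L (r k) i > 0 \<longleftrightarrow> l i > 0) sequentially" if "i < n" for i
    using order_tendstoD[OF l[OF that], of 0] that
    by (cases "l i > 0") (auto elim!: eventually_mono simp: not_less less_le)
  then have "eventually (\<lambda>k. \<forall>i\<in>{..<n}. L (r k) i > 0 \<longleftrightarrow> l i > 0) sequentially"
    by (intro eventually_ball_finite) auto
  then obtain k where "\<forall>i<n. L (r k) i > 0 \<longleftrightarrow> l i > 0"
    by (auto simp: eventually_sequentially)
  then have "{i. i < n \<and> L (r k) i > 0} = {i. i < n \<and> l i > 0}" by auto
  then have "fst (inertia (X (r k))) = fst (inertia A)"
    by (simp add: inertia_eq_card[OF X L] inertia_eq_card[OF A cA])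
  then show ?thesis ..
qed

lemma pos_inertia_constant:
  fixes X :: "real \<Rightarrow> real mat"
  assumes X: "\<And>t. X t \<in> carrier_mat n n"
    and sym: "\<And>t. transpose_mat (X t) = X t"
    and det: "\<And>t. det (X t) \<noteq> 0"
    and cont: "\<And>i j t. i < n \<Longrightarrow> j < n \<Longrightarrow> isCont (\<lambda>t. X t $$ (i,j)) t"
  shows "fst (inertia (X a)) = fst (inertia (X b))"
proof -
  have "eventually (\<lambda>s. fst (inertia (X t)) = fst (inertia (X s))) (at t)" for t
  proof (rule ccontr)
    assume neg: "\<not> ?thesis"
    \<comment> \<open>If local constancy fails at \<open>t\<close>, points with a different count
      exist arbitrarily close to \<open>t\<close>. They form a sequence tending to \<open>t\<close>
      that contradicts \<open>pos_inertia_limit\<close>.\<close>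
    have "\<exists>s. dist s t < inverse (real (Suc k)) \<and> fst (inertia (X t)) \<noteq> fst (inertia (X s))" for k
      using neg unfolding eventually_at
      by (metis inverse_positive_iff_positive of_nat_0_less_iff zero_less_Suc)
    then obtain s where s: "\<And>k. dist (s k) t < inverse (real (Suc k))"
      and ne: "\<And>k. fst (inertia (X t)) \<noteq> fst (inertia (X (s k)))"
      by metis
    have "(\<lambda>k. dist (s k) t) \<longlonglongrightarrow> 0"
      by (rule tendsto_sandwich[OF _ _ tendsto_const LIMSEQ_inverse_real_of_nat];
          intro always_eventually allI zero_le_dist less_imp_le[OF s])
    then have "s \<longlonglongrightarrow> t" by (rule tendsto_dist_iff[THEN iffD2])
    then have "\<exists>k. fst (inertia (X (s k))) = fst (inertia (X t))"
      by (intro pos_inertia_limit[OF X X sym det] isCont_tendsto_compose[OF cont])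
    with ne show False by metis
  qed
  \<comment> \<open>A locally constant function on the connected real line is constant.\<close>
  then show ?thesis
    by (intro connected_local_const[of UNIV]) auto
qed

section \<open>Half-turn paths from a matrix to its negative\<close>

lemma inertia_uminus:
  fixes A :: "real mat"
  assumes A: "A \<in> carrier_mat n n" and sym: "transpose_mat A = A"
  shows "fst (inertia (- A)) = fst (snd (inertia A))"
proof -
  obtain l where l: "char_poly A = (\<Prod>i<n. [:- l i, 1:])"
    using symmetric_char_poly_factorized[OF A sym] by blast
  have "poly (char_poly (- A)) x = poly (\<Prod>i<n. [:- (- l i), 1:]) x" for x
  proof -
    \<comment> \<open>Both sides are xI + A. Taking determinants yields the sign (-1)^n, which is
      then absorbed into the \<open>n\<close> linear factors.\<close>
    have "- char_matrix (- A) x = (- 1) \<cdot>\<^sub>m (- char_matrix A (- x))"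
      using A by (intro eq_matI) (auto simp: char_matrix_def)
    moreover have "dim_col (char_matrix A (- x)) = n" using A by (simp add: char_matrix_def)
    ultimately have "poly (char_poly (- A)) x = (- 1) ^ n * poly (char_poly A) (- x)"
      using A by (simp add: char_poly_matrix[OF A] char_poly_matrix[of "- A" n])
    also have "\<dots> = (\<Prod>i<n. (- 1) * (- l i - x))"
      by (subst prod.distrib) (simp add: l poly_prod)
    also have "\<dots> = (\<Prod>i<n. l i + x)" by (intro prod.cong) auto
    finally show ?thesis by (simp add: poly_prod)
  qed
  then have "char_poly (- A) = (\<Prod>i<n. [:- (- l i), 1:])"
    by (intro poly_eq_poly_eq_iff[THEN iffD1] ext)
  then show ?thesis
    using inertia_eq_card[OF A l] inertia_eq_card[of "- A" n "\<lambda>i. - l i"] A by simp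
qed

text \<open>Isolates the half-turn argument so that it serves both symmetric factors:
  \<open>S\<close> is \<open>T\<close> with \<open>K = T * W * T\<close>, or \<open>W\<close> with
  \<open>K = W * T * W\<close>.\<close>

lemma balanced_inertia:
  fixes S K :: "real mat"
  assumes S: "S \<in> carrier_mat n n" and K: "K \<in> carrier_mat n n"
    and sym: "transpose_mat S = S" "transpose_mat K = K"
    and det: "\<And>t. det (cos t \<cdot>\<^sub>m S + sin t \<cdot>\<^sub>m K) \<noteq> 0"
  shows "even n \<and> inertia S = (n div 2, n div 2, 0)"
proof -
  define X where "X = (\<lambda>t. cos t \<cdot>\<^sub>m S + sin t \<cdot>\<^sub>m K)"
  have "fst (inertia (X 0)) = fst (inertia (X pi))"
  proof (rule pos_inertia_constant)
    fix t
    show "X t \<in> carrier_mat n n" using S K by (simp add: X_def)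
    have "S $$ (j,i) = S $$ (i,j)" "K $$ (j,i) = K $$ (i,j)" if "i < n" "j < n" for i j
      using arg_cong[OF sym(1), of "\<lambda>M. M $$ (i,j)"] arg_cong[OF sym(2), of "\<lambda>M. M $$ (i,j)"]
        that S K by simp_all
    then show "transpose_mat (X t) = X t"
      using S K by (intro eq_matI) (auto simp: X_def)
    show "det (X t) \<noteq> 0" using det by (simp add: X_def)
    fix i j assume ij: "i < n" "j < n"
    have "(\<lambda>t. X t $$ (i,j)) = (\<lambda>t. cos t * S $$ (i,j) + sin t * K $$ (i,j))"
      using ij S K by (auto simp: X_def)
    then show "isCont (\<lambda>t. X t $$ (i,j)) t" by (auto intro!: continuous_intros)
  qed
  moreover have X0: "X 0 = S" and "X pi = - S"
    using S K by (auto simp: X_def intro!: eq_matI)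
  ultimately have pn: "fst (inertia S) = fst (snd (inertia S))"
    using inertia_uminus[OF S sym(1)] by simp
  obtain l where l: "char_poly S = (\<Prod>i<n. [:- l i, 1:])"
    using symmetric_char_poly_factorized[OF S sym(1)] by blast
  note iS = inertia_eq_card[OF S l]
  have detS: "det S \<noteq> 0" using det[of 0] X0 by (simp add: X_def)
  have nz: "l i \<noteq> 0" if "i < n" for i
    by (rule char_poly_root_nonzero[OF S l detS that])
  \<comment> \<open>With no zero root, the two sign classes exhaust all \<open>n\<close> indices;
    having equal size, they force \<open>n\<close> to be even.\<close>
  have "{..<n} = {i. i < n \<and> l i > 0} \<union> {i. i < n \<and> l i < 0}"
    using nz by (auto simp: neq_iff)
  then have "n = card ({i. i < n \<and> l i > 0} \<union> {i. i < n \<and> l i < 0})"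
    by (metis card_lessThan)
  also have "\<dots> = card {i. i < n \<and> l i > 0} + card {i. i < n \<and> l i < 0}"
    by (rule card_Un_disjoint) auto
  finally have n: "n = 2 * card {i. i < n \<and> l i > 0}" using pn iS by simp
  then have "even n" by (metis dvd_triv_left)
  moreover have "card {i. i < n \<and> l i > 0} = n div 2" using n by simp
  moreover have "card {i. i < n \<and> l i = 0} = 0" using nz by auto
  ultimately show ?thesis using pn iS by simp
qed

text \<open>If \<open>sin t\<close> is nonzero, a singular pencil would make
  \<open>- cos t / sin t\<close> a real eigenvalue of \<open>B\<close>. Otherwise
  \<open>cos t\<close> is 1 or -1 and the pencil is a nonzero multiple of the identity.\<close>

lemma det_pencil_nonzero:
  fixes B :: "real mat"
  assumes B: "B \<in> carrier_mat n n" and ev: "\<And>x. \<not> eigenvalue B x"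
  shows "det (cos t \<cdot>\<^sub>m 1\<^sub>m n + sin t \<cdot>\<^sub>m B) \<noteq> 0"
proof (cases "sin t = 0")
  case True
  then have "cos t \<cdot>\<^sub>m 1\<^sub>m n + sin t \<cdot>\<^sub>m B = cos t \<cdot>\<^sub>m 1\<^sub>m n"
    using B by (intro eq_matI) auto
  moreover have "cos t \<noteq> 0" using True sin_zero_abs_cos_one by fastforce
  ultimately show ?thesis by simp
next
  case False
  then have "cos t \<cdot>\<^sub>m 1\<^sub>m n + sin t \<cdot>\<^sub>m B = sin t \<cdot>\<^sub>m char_matrix B (- cos t / sin t)"
    using B by (intro eq_matI) (auto simp: char_matrix_def field_simps)
  then show ?thesis using False ev B eigenvalue_det[OF B] by simp
qed

theorem corollary1p6:
  fixes B T W :: "real mat" and m :: nat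
  assumes "B \<in> carrier_mat m m"
    and "T \<in> carrier_mat m m"
    and "W \<in> carrier_mat m m"
    and "invertible_mat B"
    and "B = T * W"
    and "T = transpose_mat T"
    and "W = transpose_mat W"
    and "\<And>z :: complex. eigenvalue (map_mat complex_of_real B) z \<Longrightarrow> Im z \<noteq> 0"
  shows "even m \<and> inertia T = (m div 2, m div 2, 0) \<and> inertia W = (m div 2, m div 2, 0)"
proof -
  note B = assms(1) and T = assms(2) and W = assms(3) and BTW = assms(5)
  note symT = assms(6)[symmetric] and symW = assms(7)[symmetric]
  \<comment> \<open>A real eigenvalue of \<open>B\<close> would be a complex one with vanishing
    imaginary part.\<close>
  have ev: "\<not> eigenvalue B x" for x
    using of_real_hom.eigenvalue_hom[OF B, of x] assms(8)[of "complex_of_real x"] by auto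
  have "det B \<noteq> 0" using ev[of 0] eigenvalue_zero_iff_det[OF B] by simp
  then have nz: "det T \<noteq> 0" "det W \<noteq> 0" using det_mult[OF T W] BTW by auto
  have pencil: "det (cos t \<cdot>\<^sub>m 1\<^sub>m m + sin t \<cdot>\<^sub>m B) \<noteq> 0" for t
    by (rule det_pencil_nonzero[OF B ev])
  have "even m \<and> inertia T = (m div 2, m div 2, 0)"
  proof (rule balanced_inertia[OF T, of "T * W * T"])
    show "transpose_mat (T * W * T) = T * W * T"
      using T W by (simp add: transpose_mult[of _ m m _ m] symT symW)
    fix t
    \<comment> \<open>The choice \<open>T * W * T\<close> is symmetric and equals
      \<open>B * T\<close>, so the invertible factor \<open>T\<close> splits off on the
      right.\<close>
    have "cos t \<cdot>\<^sub>m T + sin t \<cdot>\<^sub>m (T * W * T) = (cos t \<cdot>\<^sub>m 1\<^sub>m m + sin t \<cdot>\<^sub>m B) * T"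
      using B T by (simp add: BTW[symmetric] add_mult_distrib_mat[of _ m m] mult_smult_assoc_mat[of _ m m])
    then show "det (cos t \<cdot>\<^sub>m T + sin t \<cdot>\<^sub>m (T * W * T)) \<noteq> 0"
      using pencil nz B T by (simp add: det_mult[of _ m])
  qed (use T W symT in auto)
  moreover have "even m \<and> inertia W = (m div 2, m div 2, 0)"
  proof (rule balanced_inertia[OF W, of "W * T * W"])
    show "transpose_mat (W * T * W) = W * T * W"
      using T W by (simp add: transpose_mult[of _ m m _ m] symT symW)
    fix t
    \<comment> \<open>Here \<open>W * T * W\<close> equals \<open>W * B\<close>, so \<open>W\<close>
      splits off on the left and the same pencil in \<open>B\<close> remains.\<close>
    have "cos t \<cdot>\<^sub>m W + sin t \<cdot>\<^sub>m (W * T * W) = W * (cos t \<cdot>\<^sub>m 1\<^sub>m m + sin t \<cdot>\<^sub>m B)"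
      using T W by (simp add: BTW mult_add_distrib_mat[of W m m _ m] mult_smult_distrib[of W m m _ m])
    then show "det (cos t \<cdot>\<^sub>m W + sin t \<cdot>\<^sub>m (W * T * W)) \<noteq> 0"
      using pencil nz B W by (simp add: det_mult[of _ m])
  qed (use T W symW in auto)
  ultimately show ?thesis by simp
qed

end
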